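(* Let $0 \leq \gamma < 1$, and let $\alpha, \beta > 0$ be such that $\alpha + \beta = 1 - \gamma$. Let $T_{\alpha,\beta}$ be the operator given by $$(T_{\alpha, \beta} \, b)(j) = \sum_{i \in \mathbb{Z},\, i \neq \pm j} \frac{b(i)}{|i-j|^{\alpha} |i+j|^{\beta}}, \qquad j \in \mathbb{Z}.$$ If $1 < p < \gamma^{-1}$ (meaning $1 < p < \infty$ when $\gamma = 0$) and $\frac{1}{q} = \frac{1}{p} - \gamma$, then for every $b \in \ell^{p}(\mathbb{Z})$ $$\| T_{\alpha, \beta} \, b \|_{\ell^{q}(\mathbb{Z})} \leq C \| b \|_{\ell^{p}(\mathbb{Z})},$$ where $C$ depends only on $\alpha$, $\beta$, $p$ and $q$.
   Context: Sequences $b = \{b(i)\}_{i \in \mathbb{Z}}$ are complex-valued. For $0 < p < \infty$, $\|b\|_{\ell^p(\mathbb{Z})} = \left( \sum_{i \in \mathbb{Z}} |b(i)|^p \right)^{1/p}$, and $b \in \ell^p(\mathbb{Z})$ means $\|b\|_{\ell^p(\mathbb{Z})} < +\infty$. *)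

theory Defs
  imports "HOL-Analysis.Analysis"
begin

text \<open>
  The spaces \<open>\<ell>\<^sup>p(\<int>)\<close> of bi-infinite complex sequences, for \<open>0 < p < \<infinity>\<close>. An unordered sum that
  diverges has the value 0 in HOL, so finiteness of the norm is expressed as summability
  of \<open>|b(i)|\<^sup>p\<close>, and \<open>lp_norm\<close> is meaningful only on \<open>lp_space\<close>.
\<close>

definition lp_space :: "real \<Rightarrow> (int \<Rightarrow> complex) set" where
  "lp_space p = {b. (\<lambda>i. norm (b i) powr p) summable_on UNIV}"

definition lp_norm :: "real \<Rightarrow> (int \<Rightarrow> complex) \<Rightarrow> real" where
  "lp_norm p b = (\<Sum>\<^sub>\<infinity>i\<in>UNIV. norm (b i) powr p) powr (1 / p)"

definition T_summand :: "real \<Rightarrow> real \<Rightarrow> (int \<Rightarrow> complex) \<Rightarrow> int \<Rightarrow> int \<Rightarrow> complex" where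
  "T_summand \<alpha> \<beta> b j i =
     b i / complex_of_real (real_of_int \<bar>i - j\<bar> powr \<alpha> * real_of_int \<bar>i + j\<bar> powr \<beta>)"

text \<open>
  The value below is the intended one only if the series converges. For complex-valued families
  \<open>summable_on\<close> is the same as absolute summability.
\<close>

definition T_op :: "real \<Rightarrow> real \<Rightarrow> (int \<Rightarrow> complex) \<Rightarrow> int \<Rightarrow> complex" where
  "T_op \<alpha> \<beta> b j = (\<Sum>\<^sub>\<infinity>i\<in>{i. i \<noteq> j \<and> i \<noteq> - j}. T_summand \<alpha> \<beta> b j i)"

definition T_converges :: "real \<Rightarrow> real \<Rightarrow> (int \<Rightarrow> complex) \<Rightarrow> bool" where
  "T_converges \<alpha> \<beta> b \<longleftrightarrow>
     (\<forall>j. T_summand \<alpha> \<beta> b j summable_on {i. i \<noteq> j \<and> i \<noteq> - j})"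

end

theory Submission
  imports Defs
begin

text \<open>
  Write \<open>K(i,j) = |i-j|\<^sup>-\<^sup>\<alpha> |i+j|\<^sup>-\<^sup>\<beta>\<close>, \<open>r = 1/(1-\<gamma>)\<close> and \<open>p' = p/(p-1)\<close>. The kernel is homogeneous of
  degree \<open>-(1-\<gamma>)\<close>, so \<open>K\<^sup>r\<close> is homogeneous of degree \<open>-1\<close>, whatever \<open>\<gamma>\<close> is. The exponents
  \<open>\<alpha>r\<close> and \<open>\<beta>r\<close> are positive with sum 1, hence both smaller than 1: the singularities
  on the diagonal and on the antidiagonal are summable. Unlike for the fractional integral with
  kernel \<open>|i-j|\<close> to the power \<open>\<gamma>-1\<close>, nothing critical happens there. The only critical behaviour is the
  homogeneity itself, and a Schur test with power weights takes care of it.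

  The kernel estimate is (\<open>kernel_Schur_bound_int\<close>) that for every \<open>0 < t < 1\<close>
  \<open>\<Sum>\<^sub>i K(i,j)\<^sup>r (1+|i|)\<^sup>-\<^sup>t \<le> A (1+|j|)\<^sup>-\<^sup>t\<close>,
  and by symmetry the same with \<open>i\<close> and \<open>j\<close> exchanged. It follows by comparing \<open>|i|\<close> with \<open>|j|\<close>: if one
  of them is at least twice the other, \<open>K\<^sup>r\<close> is of the order of the reciprocal of the larger one;
  otherwise the weight is essentially constant and the singularity is summed over a range of length
  \<open>|j|\<close>.

  To pass from this estimate to the operator bound (\<open>weighted_Young_finite\<close>), Young's convolution argument is run
  with the weight \<open>u(i) = (1+|i|)\<^sup>s\<close> inserted. Since \<open>1/q + 1/p' + \<gamma> = 1\<close> and \<open>1/q + 1/p' = 1/r\<close>,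
  \<open>K |b| = (K\<^sup>r |b|\<^sup>p u\<^sup>q) powr (1/q) * (K\<^sup>r u powr (-p')) powr (1/p') * (|b|\<^sup>p) powr \<gamma>\<close>,
  and Hoelder's inequality with three factors bounds the sum over \<open>i\<close>. The second factor is controlled
  by the kernel estimate with \<open>t = sp'\<close>; after taking the \<open>q\<close>-th power and summing over \<open>j\<close>, the first
  one is controlled by the estimate with \<open>t = sq\<close>. Both values of \<open>t\<close> lie between 0 and 1 once \<open>s\<close> is small.
  This covers \<open>\<gamma> = 0\<close>, where \<open>p = q\<close> and the argument is the ordinary Schur test, and \<open>\<gamma> > 0\<close> alike.

  All inequalities are proved for finite sums, where no convergence question arises; the uniform
  bound then yields absolute convergence and passes to the limit (\<open>finite_section_bound_extends\<close>).
\<close>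

section \<open>Hoelder's inequality and the weighted Young inequality\<close>

text \<open>
  The logarithm lies below its tangent at the weighted mean \<open>m\<close>; the linear terms cancel on averaging.
\<close>
lemma weighted_AM_GM3:
  fixes x y z a b c :: real
  assumes "x > 0" "y > 0" "z > 0" "a \<ge> 0" "b \<ge> 0" "c \<ge> 0" "a + b + c = 1"
  shows "x powr a * y powr b * z powr c \<le> a * x + b * y + c * z"
proof -
  define m where "m = a * x + b * y + c * z"
  have m: "m > 0"
  proof -
    have "a > 0 \<or> b > 0 \<or> c > 0" using assms by linarith
    then show ?thesis unfolding m_def
      using assms by (smt (verit) mult_nonneg_nonneg mult_pos_pos)
  qed
  have tangent: "ln w \<le> ln m + (w / m - 1)" if "w > 0" for w
    using ln_le_minus_one[of "w / m"] that m by (simp add: ln_div)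
  have "a * ln x + b * ln y + c * ln z
      \<le> a * (ln m + (x / m - 1)) + b * (ln m + (y / m - 1)) + c * (ln m + (z / m - 1))"
    using assms tangent by (intro add_mono mult_left_mono) auto
  also have "\<dots> = (a + b + c) * (ln m - 1) + (a * x + b * y + c * z) / m"
    by (simp add: algebra_simps add_divide_distrib)
  also have "\<dots> = ln m" using m assms by (simp flip: m_def)
  finally have "exp (a * ln x + b * ln y + c * ln z) \<le> m" 
    using m by (metis exp_le_cancel_iff exp_ln)
  then show ?thesis using assms by (simp add: powr_def exp_add m_def)
qed

text \<open>
  The weighted inequality of means, applied to the entries divided by the respective total sums.
  Zero exponents are admitted because the case \<open>\<gamma> = 0\<close> gives the third factor exponent 0; as
  \<open>0 powr 0 = 0\<close>, that factor then is 1 on the support of \<open>z\<close> and 0 off it.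
\<close>
lemma sum_Holder3:
  fixes x y z :: "'a \<Rightarrow> real"
  assumes "finite F" and "\<And>i. i \<in> F \<Longrightarrow> x i \<ge> 0" "\<And>i. i \<in> F \<Longrightarrow> y i \<ge> 0" "\<And>i. i \<in> F \<Longrightarrow> z i \<ge> 0"
    and abc: "a \<ge> 0" "b \<ge> 0" "c \<ge> 0" "a + b + c = 1"
  shows "(\<Sum>i\<in>F. x i powr a * y i powr b * z i powr c)
      \<le> sum x F powr a * sum y F powr b * sum z F powr c"
proof (cases "sum x F = 0 \<or> sum y F = 0 \<or> sum z F = 0")
  case True
  then have "\<forall>i\<in>F. x i powr a * y i powr b * z i powr c = 0"
    using assms(1-4) by (auto simp: sum_nonneg_eq_0_iff)
  then show ?thesis by (simp add: sum.neutral)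
next
  case False
  define X Y Z where "X = sum x F" and "Y = sum y F" and "Z = sum z F"
  have pos: "X > 0" "Y > 0" "Z > 0"
    using False assms(2-4) by (auto simp: X_def Y_def Z_def less_le intro!: sum_nonneg)
  have "x i powr a * y i powr b * z i powr c
      \<le> X powr a * Y powr b * Z powr c * (a * (x i / X) + b * (y i / Y) + c * (z i / Z))"
    if i: "i \<in> F" for i
  proof (cases "x i = 0 \<or> y i = 0 \<or> z i = 0")
    case True
    then show ?thesis using pos abc assms(2-4)[OF i]
      by (auto intro!: mult_nonneg_nonneg add_nonneg_nonneg)
  next
    case False
    then have p: "x i > 0" "y i > 0" "z i > 0" using assms(2-4)[OF i] by auto
    have "x i powr a * y i powr b * z i powr c = X powr a * Y powr b * Z powr c *
        ((x i / X) powr a * (y i / Y) powr b * (z i / Z) powr c)"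
      using p pos by (simp add: powr_divide)
    also have "\<dots> \<le> X powr a * Y powr b * Z powr c * (a * (x i / X) + b * (y i / Y) + c * (z i / Z))"
      using p pos abc by (intro mult_left_mono weighted_AM_GM3) auto
    finally show ?thesis .
  qed
  then have "(\<Sum>i\<in>F. x i powr a * y i powr b * z i powr c) \<le>
      (\<Sum>i\<in>F. X powr a * Y powr b * Z powr c * (a * (x i / X) + b * (y i / Y) + c * (z i / Z)))"
    by (rule sum_mono)
  also have "\<dots> = X powr a * Y powr b * Z powr c * (a * (X / X) + b * (Y / Y) + c * (Z / Z))"
    unfolding X_def Y_def Z_def
    by (simp add: sum.distrib flip: sum_distrib_left sum_divide_distrib)
  also have "\<dots> = X powr a * Y powr b * Z powr c" using pos abc by simp
  finally show ?thesis by (simp add: X_def Y_def Z_def)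
qed

text \<open>
  For constant weights the hypotheses say that the rows and columns of \<open>K\<close> are bounded in \<open>\<ell>\<^sup>r\<close>, and
  this is the usual proof of Young's inequality; for \<open>\<gamma> = 0\<close> it is Schur's test. The powers \<open>-p'\<close>
  and \<open>-q\<close> of the weights are chosen so that they cancel: what the row bound leaves, \<open>v powr (-q)\<close>, is
  what the column bound takes, and that returns \<open>u powr (-q)\<close> against the factor \<open>u powr q\<close> put in.
\<close>
lemma weighted_Young_finite:
  fixes K :: "'a \<Rightarrow> 'b \<Rightarrow> real" and u :: "'a \<Rightarrow> real" and v :: "'b \<Rightarrow> real" and b :: "'a \<Rightarrow> real"
  assumes K: "\<And>i j. K i j \<ge> 0" and u: "\<And>i. u i > 0" and v: "\<And>j. v j > 0" and b: "\<And>i. b i \<ge> 0"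
    and exps: "1 < p" "0 < q" "0 < r" "0 \<le> \<gamma>" "1 / q = 1 / p - \<gamma>" "1 / r = 1 - \<gamma>" "p' = p / (p - 1)"
    and A: "A \<ge> 0"
    and row: "\<And>j F. finite F \<Longrightarrow> (\<Sum>i\<in>F. K i j powr r * u i powr - p') \<le> A * v j powr - p'"
    and col: "\<And>i G. finite G \<Longrightarrow> (\<Sum>j\<in>G. K i j powr r * v j powr - q) \<le> A * u i powr - q"
    and fin: "finite F" "finite G"
  shows "(\<Sum>j\<in>G. (\<Sum>i\<in>F. K i j * b i) powr q) \<le> A powr (q / r) * (\<Sum>i\<in>F. b i powr p) powr (q / p)"
proof -
  define B where "B = (\<Sum>i\<in>F. b i powr p)"
  have B0: "B \<ge> 0" by (auto simp: B_def intro: sum_nonneg)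
  have p': "p' > 0" "1 / p' = 1 - 1 / p"
    unfolding exps(7) using exps(1) by (simp_all add: field_simps)
  have e1: "1 / q + 1 / p' + \<gamma> = 1" using p' exps by simp
  have nn: "1 / q \<ge> 0" "1 / p' \<ge> 0" "\<gamma> \<ge> 0" using exps(2,4) p'(1) by auto
  have e2: "r * (1 / q) + r * (1 / p') = 1"
  proof -
    have "r * (1 / q) + r * (1 / p') = r * (1 / q + 1 / p')" by (simp only: distrib_left)
    also have "1 / q + 1 / p' = 1 / r" using e1 exps(6) by linarith
    also have "r * (1 / r) = 1" using exps(3) by simp
    finally show ?thesis .
  qed
  have e3: "p * (1 / q) + p * \<gamma> = 1" 
  proof -
    have "p * (1 / q) + p * \<gamma> = p * (1 / p)" unfolding exps(5) by (simp add: algebra_simps)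
    then show ?thesis using exps by simp
  qed
  (* The factorisation to which the three-factor inequality of Hoelder is applied; e2 and e3 are the
     balances of the exponents of K and b, and the two powers of u are 1 and -1. *)
  have split: "K i j * b i = (K i j powr r * b i powr p * u i powr q) powr (1 / q)
      * (K i j powr r * u i powr - p') powr (1 / p') * (b i powr p) powr \<gamma>" for i j
  proof -
    have "(K i j powr r * b i powr p * u i powr q) powr (1 / q)
      * (K i j powr r * u i powr - p') powr (1 / p') * (b i powr p) powr \<gamma>
      = (K i j powr (r * (1 / q)) * K i j powr (r * (1 / p'))) * 
        (b i powr (p * (1 / q)) * b i powr (p * \<gamma>)) * (u i powr 1 * u i powr - 1)"
      using K[of i j] u[of i] b[of i] p'(1) exps(2)
      by (simp add: powr_mult powr_powr)
    also have "\<dots> = K i j powr 1 * b i powr 1 * u i powr 0"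
      unfolding powr_add[symmetric] e2 e3 by simp
    finally show ?thesis using K[of i j] u[of i] b[of i] by simp
  qed
  have inner: "(\<Sum>i\<in>F. K i j * b i) powr q
      \<le> A powr (q / p') * B powr (\<gamma> * q) * (\<Sum>i\<in>F. b i powr p * u i powr q * (K i j powr r * v j powr - q))" for j
  proof -
    define S where "S = (\<Sum>i\<in>F. K i j powr r * b i powr p * u i powr q)"
    have S0: "S \<ge> 0" by (auto simp: S_def intro: sum_nonneg)
    have "(\<Sum>i\<in>F. K i j * b i) \<le> S powr (1 / q) *
        (\<Sum>i\<in>F. K i j powr r * u i powr - p') powr (1 / p') * B powr \<gamma>"
      unfolding S_def B_def split
      by (intro sum_Holder3 fin e1 nn) auto
    also have "\<dots> \<le> S powr (1 / q) * (A * v j powr - p') powr (1 / p') * B powr \<gamma>"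
      using row[OF fin(1), of j] nn
      by (intro mult_right_mono mult_left_mono powr_mono2 sum_nonneg) auto
    finally have "(\<Sum>i\<in>F. K i j * b i) powr q
        \<le> (S powr (1 / q) * (A * v j powr - p') powr (1 / p') * B powr \<gamma>) powr q"
      using K b exps by (intro powr_mono2 sum_nonneg) auto
    also have "\<dots> = S * (A powr (q / p') * v j powr - q) * B powr (\<gamma> * q)"
    proof -
      have "(S powr (1 / q) * (A * v j powr - p') powr (1 / p') * B powr \<gamma>) powr q
        = S powr (1 / q * q) * (A powr (1 / p' * q) * v j powr (- p' * (1 / p') * q)) * B powr (\<gamma> * q)"
        using S0 A v[of j] B0 by (simp only: powr_mult powr_powr powr_ge_zero mult_nonneg_nonneg)
      moreover have "1 / q * q = 1" "1 / p' * q = q / p'" "- p' * (1 / p') * q = - q"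
        using p'(1) exps(2) by auto
      ultimately show ?thesis using S0 p'(1) exps(2) by simp
    qed
    also have "\<dots> = A powr (q / p') * B powr (\<gamma> * q) * (S * v j powr - q)" by simp
    also have "S * v j powr - q = (\<Sum>i\<in>F. b i powr p * u i powr q * (K i j powr r * v j powr - q))"
      unfolding S_def sum_distrib_right by (simp add: mult_ac)
    finally show ?thesis .
  qed
  have "(\<Sum>j\<in>G. (\<Sum>i\<in>F. K i j * b i) powr q) \<le> 
     (\<Sum>j\<in>G. A powr (q / p') * B powr (\<gamma> * q) * (\<Sum>i\<in>F. b i powr p * u i powr q * (K i j powr r * v j powr - q)))"
    by (intro sum_mono inner)
  also have "\<dots> = A powr (q / p') * B powr (\<gamma> * q) * 
      (\<Sum>i\<in>F. b i powr p * u i powr q * (\<Sum>j\<in>G. K i j powr r * v j powr - q))"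
    unfolding sum_distrib_left by (rule sum.swap)
  also have "\<dots> \<le> A powr (q / p') * B powr (\<gamma> * q) * 
      (\<Sum>i\<in>F. b i powr p * u i powr q * (A * u i powr - q))"
    using fin(2) by (intro mult_left_mono sum_mono col) auto
  also have "(\<Sum>i\<in>F. b i powr p * u i powr q * (A * u i powr - q)) = A * B"
    using u by (simp add: B_def sum_distrib_left powr_minus mult_ac less_imp_neq[THEN not_sym])
  also have "A powr (q / p') * B powr (\<gamma> * q) * (A * B) = A powr (q / r) * B powr (q / p)"
  proof -
    have "q / p' + 1 = q * (1 / p' + 1 / q)" using exps(2) by (simp add: distrib_left)
    also have "1 / p' + 1 / q = 1 / r" using e1 exps(6) by linarith
    finally have a: "q / p' + 1 = q / r" by simp
    have "\<gamma> * q + 1 = q * (\<gamma> + 1 / q)" using exps(2) by (simp add: distrib_left)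
    also have "\<gamma> + 1 / q = 1 / p" using exps(5) by linarith
    finally have c: "\<gamma> * q + 1 = q / p" by simp
    have "A powr (q / p') * A powr 1 = A powr (q / r)" "B powr (\<gamma> * q) * B powr 1 = B powr (q / p)"
      unfolding powr_add[symmetric] a c by simp_all
    then have "A powr (q / p') * A = A powr (q / r)" "B powr (\<gamma> * q) * B = B powr (q / p)"
      using A B0 by simp_all
    then show ?thesis by (metis mult.assoc mult.commute)
  qed
  finally show ?thesis by (simp add: B_def)
qed

section \<open>Sums of powers\<close>

text \<open>
  Telescoping: Young's inequality \<open>N powr (1 - c) * (1 + N) powr c \<le> N + c\<close> bounds each
  term by the corresponding increment of \<open>x powr (1 - c) / (1 - c)\<close>.
\<close>
lemma sum_powr_le:
  fixes c :: real
  assumes "0 < c" "c < 1"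
  shows "(\<Sum>n<N. (1 + real n) powr - c) \<le> real N powr (1 - c) / (1 - c)"
proof (induction N)
  case 0
  then show ?case by simp
next
  case (Suc N)
  have "real N powr (1 - c) * (1 + real N) powr c \<le> (1 - c) * real N + c * (1 + real N)"
    using assms by (cases "N = 0") (auto intro!: Youngs_inequality_0)
  then have "real N powr (1 - c) * (1 + real N) powr c * (1 + real N) powr - c
      \<le> ((1 + real N) - (1 - c)) * (1 + real N) powr - c"
    by (intro mult_right_mono) (auto simp: algebra_simps)
  also have "\<dots> = (1 + real N) powr (1 - c) - (1 - c) * (1 + real N) powr - c"
    by (simp add: left_diff_distrib powr_diff powr_minus field_simps)
  also have "real N powr (1 - c) * (1 + real N) powr c * (1 + real N) powr - c = real N powr (1 - c)"
    by (simp add: powr_minus)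
  finally have "real N powr (1 - c) + (1 - c) * (1 + real N) powr - c \<le> (1 + real N) powr (1 - c)"
    by simp
  then have "(real N powr (1 - c) + (1 - c) * (1 + real N) powr - c) / (1 - c) \<le> (1 + real N) powr (1 - c) / (1 - c)"
    using assms by (intro divide_right_mono) auto
  then have "real N powr (1 - c) / (1 - c) + (1 + real N) powr - c \<le> (1 + real N) powr (1 - c) / (1 - c)"
    using assms by (simp add: add_divide_distrib)
  with Suc show ?case by simp
qed

text \<open>
  Again telescoping, now against the decrements of \<open>x powr (- t)\<close>. Bounding \<open>1 + x\<close> by \<open>2 * x\<close> costs the
  factor 2 and lets the sum start at its first term without a correction.
\<close>
lemma sum_powr_tail_le:
  fixes t :: real
  assumes "0 < t" "t < 1"
  shows "(\<Sum>n=m..<N. (1 + real n) powr (- 1 - t)) \<le> 2 / t * (1 + real m) powr - t"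
proof -
  have step: "(1 + real n) powr (- 1 - t) \<le> 2 / t * ((1 + real n) powr - t - (1 + real (Suc n)) powr - t)" for n
  proof -
    define x where "x = 1 + real n"
    have x: "x \<ge> 1" by (simp add: x_def)
    have "x powr t * (1 + x) powr (1 - t) \<le> t * x + (1 - t) * (1 + x)"
      using assms x by (intro Youngs_inequality_0) auto
    also have "\<dots> \<le> (1 + x) * (1 - t / (2 * x))"
      using assms x by (simp add: field_simps)
    finally have "(x powr t * (1 + x) powr (1 - t)) * (x powr - t / (1 + x))
       \<le> ((1 + x) * (1 - t / (2 * x))) * (x powr - t / (1 + x))"
      using x by (intro mult_right_mono) auto
    also have "(x powr t * (1 + x) powr (1 - t)) * (x powr - t / (1 + x)) = (1 + x) powr - t"
    proof -
      have "x powr t * x powr - t = 1" "(1 + x) powr (1 - t) = (1 + x) * (1 + x) powr - t"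
        using x by (simp_all add: powr_minus powr_diff divide_inverse)
      then show ?thesis using x by simp
    qed
    also have "((1 + x) * (1 - t / (2 * x))) * (x powr - t / (1 + x)) = x powr - t - t / 2 * x powr (- 1 - t)"
    proof -
      have "((1 + x) * (1 - t / (2 * x))) * (w / (1 + x)) = (1 - t / (2 * x)) * w" for w
        using x by simp
      also have "(1 - t / (2 * x)) * w = w - t / 2 * (w / x)" for w
        by (simp add: left_diff_distrib)
      moreover have "x powr (- 1 - t) = x powr - t / x"
        using x powr_diff[of x "- t" 1] by (simp add: minus_diff_commute)
      ultimately show ?thesis by simp
    qed
    finally show ?thesis using assms x by (simp add: field_simps flip: x_def)
  qed
  have "(\<Sum>n=m..<N. (1 + real n) powr (- 1 - t))
     \<le> 2 / t * (\<Sum>n=m..<N. (1 + real n) powr - t - (1 + real (Suc n)) powr - t)"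
    unfolding sum_distrib_left by (intro sum_mono step)
  also have "\<dots> \<le> 2 / t * (1 + real m) powr - t"
  proof (cases "m \<le> N")
    case True
    have "(\<Sum>n=m..<N. (1 + real n) powr - t - (1 + real (Suc n)) powr - t) = 
       (1 + real m) powr - t - (1 + real N) powr - t"
      using sum_Suc_diff'[OF True, of "\<lambda>n. - ((1 + real n) powr - t)"] by simp
    then show ?thesis using assms by (intro mult_left_mono) auto
  qed (use assms in auto)
  finally show ?thesis .
qed

section \<open>The kernel estimate\<close>

text \<open>
  On nonnegative arguments the kernel with the stronger singularity \<open>c\<close> on the diagonal is
  compared with three simpler ones, according to whether \<open>n\<close> is at most \<open>m / 2\<close>, at least \<open>2 * m\<close>, or
  comparable to \<open>m\<close>. In the first two cases both \<open>|n - m|\<close> and \<open>n + m\<close> are of the size of the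
  larger number, so that only the total degree -1 is felt.
\<close>
lemma kernel_region_bounds:
  fixes m n :: nat and c t :: real
  assumes "n \<noteq> m" "0 < c" "c < 1" "0 < t" "t < 1"
  defines "G \<equiv> \<bar>real n - real m\<bar> powr - c * (real n + real m) powr (c - 1) * (1 + real n) powr - t"
  shows "2 * n \<le> m \<Longrightarrow> G \<le> 4 / (1 + real m) * (1 + real n) powr - t"
    and "2 * m \<le> n \<Longrightarrow> G \<le> 4 * (1 + real n) powr (- 1 - t)"
    and "m < 2 * n \<Longrightarrow> n < 2 * m \<Longrightarrow> G \<le> 2 * (1 + real m) powr (c - 1 - t) * \<bar>real n - real m\<bar> powr - c"
proof -
  have far: "\<bar>real n - real m\<bar> powr - c * (real n + real m) powr (c - 1) \<le> 4 / (1 + w)"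
    if "w \<ge> 0" "1 + w \<le> 4 * \<bar>real n - real m\<bar>" "1 + w \<le> 4 * (real n + real m)" for w
  proof -
    have "\<bar>real n - real m\<bar> powr - c * (real n + real m) powr (c - 1)
        \<le> ((1 + w) / 4) powr - c * ((1 + w) / 4) powr (c - 1)"
      using assms that by (intro mult_mono powr_mono2') auto
    also have "\<dots> = ((1 + w) / 4) powr - 1" by (simp flip: powr_add)
    also have "\<dots> = 4 / (1 + w)" using that by (simp add: powr_minus_divide)
    finally show ?thesis .
  qed
  show "G \<le> 4 / (1 + real m) * (1 + real n) powr - t" if "2 * n \<le> m"
    unfolding G_def using that \<open>n \<noteq> m\<close> by (intro mult_right_mono far) auto
  show "G \<le> 4 * (1 + real n) powr (- 1 - t)" if "2 * m \<le> n"
  proof -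
    have "G \<le> 4 / (1 + real n) * (1 + real n) powr - t"
      unfolding G_def using that \<open>n \<noteq> m\<close> by (intro mult_right_mono far) auto
    also have "\<dots> = 4 * (1 + real n) powr (- 1 - t)" by (simp add: powr_diff powr_minus field_simps)
    finally show "G \<le> 4 * (1 + real n) powr (- 1 - t)" .
  qed
  show "G \<le> 2 * (1 + real m) powr (c - 1 - t) * \<bar>real n - real m\<bar> powr - c"
    if near: "m < 2 * n" "n < 2 * m"
  proof -
    have "(1 + real n) powr - t \<le> ((1 + real m) / 2) powr - t"
      using near assms by (intro powr_mono2') auto
    also have "\<dots> = 2 powr t * (1 + real m) powr - t" by (simp add: powr_divide powr_minus field_simps)
    also have "\<dots> \<le> 2 powr 1 * (1 + real m) powr - t"
      using assms by (intro mult_right_mono powr_mono) auto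
    finally have 1: "(1 + real n) powr - t \<le> 2 * (1 + real m) powr - t" by simp
    have 2: "(real n + real m) powr (c - 1) \<le> (1 + real m) powr (c - 1)"
      using near assms by (intro powr_mono2') auto
    have "G \<le> \<bar>real n - real m\<bar> powr - c * (1 + real m) powr (c - 1) * (2 * (1 + real m) powr - t)"
      unfolding G_def using 1 2 by (intro mult_mono) auto
    also have "(1 + real m) powr (c - 1 - t) = (1 + real m) powr (c - 1) * (1 + real m) powr - t"
      by (simp flip: powr_add)
    then have "\<bar>real n - real m\<bar> powr - c * (1 + real m) powr (c - 1) * (2 * (1 + real m) powr - t)
      = 2 * (1 + real m) powr (c - 1 - t) * \<bar>real n - real m\<bar> powr - c" by simp
    finally show ?thesis .
  qed
qed

text \<open>
  Each distance \<open>1, ..., m\<close> from \<open>m\<close> occurs at most twice.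
\<close>
lemma sum_near_diagonal_le:
  fixes m :: nat and c :: real
  assumes "0 < c" "c < 1" "finite F" "\<And>n. n \<in> F \<Longrightarrow> n \<noteq> m \<and> n < 2 * m"
  shows "(\<Sum>n\<in>F. \<bar>real n - real m\<bar> powr - c) \<le> 2 / (1 - c) * (1 + real m) powr (1 - c)"
proof -
  define f where "f n = \<bar>real n - real m\<bar> powr - c" for n
  have "F \<subseteq> (\<lambda>k. m + 1 + k) ` {..<m} \<union> (\<lambda>k. m - 1 - k) ` {..<m}" 
  proof
    fix n assume "n \<in> F"
    from assms(4)[OF this] have n: "n \<noteq> m" "n < 2 * m" by auto
    show "n \<in> (\<lambda>k. m + 1 + k) ` {..<m} \<union> (\<lambda>k. m - 1 - k) ` {..<m}"
    proof (cases "m < n")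
      case True
      then have "n = m + 1 + (n - m - 1)" "n - m - 1 < m" using n by auto
      then show ?thesis by blast
    next
      case False
      then have "n = m - 1 - (m - n - 1)" "m - n - 1 < m" using n by auto
      then show ?thesis by blast
    qed
  qed
  then have "sum f F \<le> sum f ((\<lambda>k. m + 1 + k) ` {..<m} \<union> (\<lambda>k. m - 1 - k) ` {..<m})"
    by (intro sum_mono2) (auto simp: f_def)
  also have "\<dots> \<le> sum f ((\<lambda>k. m + 1 + k) ` {..<m}) + sum f ((\<lambda>k. m - 1 - k) ` {..<m})"
    by (subst sum.union_inter [symmetric]) (auto intro!: sum_nonneg simp: f_def)
  also have "sum f ((\<lambda>k. m + 1 + k) ` {..<m}) = (\<Sum>k<m. (1 + real k) powr - c)"
    by (subst sum.reindex) (auto simp: f_def o_def)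
  also have "sum f ((\<lambda>k. m - 1 - k) ` {..<m}) = (\<Sum>k<m. (1 + real k) powr - c)"
    by (subst sum.reindex) (auto simp: f_def o_def inj_on_def of_nat_diff intro!: sum.cong)
  also have "(\<Sum>k<m. (1 + real k) powr - c) + (\<Sum>k<m. (1 + real k) powr - c)
      \<le> 2 * (real m powr (1 - c) / (1 - c))"
    using sum_powr_le[OF assms(1,2), of m] by simp
  also have "\<dots> \<le> 2 * ((1 + real m) powr (1 - c) / (1 - c))"
    using assms by (intro mult_left_mono divide_right_mono powr_mono2) auto
  finally show ?thesis by (simp add: f_def)
qed

text \<open>
  The conditions \<open>t < 1\<close>, \<open>t > 0\<close> and \<open>c < 1\<close> make the sums over small \<open>n\<close>, over large \<open>n\<close>
  and near the diagonal, respectively, of the right order; these are the three parts of the constant.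
\<close>
lemma kernel_Schur_bound_nat:
  fixes m :: nat and c t :: real
  assumes c: "0 < c" "c < 1" and t: "0 < t" "t < 1" and F: "finite F" "m \<notin> F"
  shows "(\<Sum>n\<in>F. \<bar>real n - real m\<bar> powr - c * (real n + real m) powr (c - 1) * (1 + real n) powr - t)
      \<le> (4 / (1 - t) + 8 / t + 4 / (1 - c)) * (1 + real m) powr - t"
proof -
  define G where "G n = \<bar>real n - real m\<bar> powr - c * (real n + real m) powr (c - 1) * (1 + real n) powr - t" for n
  define N where "N = {n\<in>F. m < 2 * n \<and> n < 2 * m}"
  define L where "L = {n\<in>F. 2 * n \<le> m}"
  define H where "H = {n\<in>F. 2 * m \<le> n}"
  note pw = kernel_region_bounds[OF _ c t, of _ m, folded G_def]
  have F_eq: "F = L \<union> H \<union> N" by (auto simp: N_def L_def H_def)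
  have fin: "finite L" "finite H" "finite N" using F by (auto simp: N_def L_def H_def)
  have "sum G F = sum G L + sum G H + sum G N"
  proof -
    have "x \<noteq> m" if "x \<in> F" for x using F that by blast
    then have "L \<inter> H = {}" "(L \<union> H) \<inter> N = {}" by (fastforce simp: N_def L_def H_def)+
    then show ?thesis unfolding F_eq using fin by (simp add: sum.union_disjoint)
  qed
  also have "sum G L \<le> 4 / (1 - t) * (1 + real m) powr - t"
  proof -
    have "sum G L \<le> (\<Sum>n\<in>L. 4 / (1 + real m) * (1 + real n) powr - t)"
      by (intro sum_mono) (use pw(1) F in \<open>force simp: L_def\<close>)
    also have "\<dots> \<le> (\<Sum>n<Suc m. 4 / (1 + real m) * (1 + real n) powr - t)"
      by (intro sum_mono2) (auto simp: L_def)
    also have "\<dots> = 4 / (1 + real m) * (\<Sum>n<Suc m. (1 + real n) powr - t)"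
      by (rule sum_distrib_left [symmetric])
    also have "\<dots> \<le> 4 / (1 + real m) * (real (Suc m) powr (1 - t) / (1 - t))"
      by (intro mult_left_mono sum_powr_le t) auto
    also have "real (Suc m) powr (1 - t) = (1 + real m) * (1 + real m) powr - t"
      by (simp add: powr_diff powr_minus divide_inverse)
    also have "4 / (1 + real m) * ((1 + real m) * (1 + real m) powr - t / (1 - t)) = 4 / (1 - t) * (1 + real m) powr - t"
      by simp
    finally show ?thesis .
  qed
  also have "sum G H \<le> 8 / t * (1 + real m) powr - t"
  proof -
    obtain M where M: "H \<subseteq> {..<M}" using fin(2) finite_nat_iff_bounded by blast
    have "sum G H \<le> (\<Sum>n\<in>H. 4 * (1 + real n) powr (- 1 - t))"
      by (intro sum_mono) (use pw(2) F in \<open>force simp: H_def\<close>)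
    also have "\<dots> \<le> (\<Sum>n=m..<M. 4 * (1 + real n) powr (- 1 - t))"
      using M by (intro sum_mono2) (auto simp: H_def)
    also have "\<dots> = 4 * (\<Sum>n=m..<M. (1 + real n) powr (- 1 - t))"
      by (rule sum_distrib_left [symmetric])
    also have "\<dots> \<le> 4 * (2 / t * (1 + real m) powr - t)"
      by (intro mult_left_mono sum_powr_tail_le t) auto
    finally show ?thesis by simp
  qed
  also have "sum G N \<le> 4 / (1 - c) * (1 + real m) powr - t"
  proof -
    have "sum G N \<le> (\<Sum>n\<in>N. 2 * (1 + real m) powr (c - 1 - t) * \<bar>real n - real m\<bar> powr - c)"
      by (intro sum_mono) (use pw(3) F in \<open>force simp: N_def\<close>)
    also have "\<dots> = 2 * (1 + real m) powr (c - 1 - t) * (\<Sum>n\<in>N. \<bar>real n - real m\<bar> powr - c)"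
      by (rule sum_distrib_left [symmetric])
    also have "\<dots> \<le> 2 * (1 + real m) powr (c - 1 - t) * (2 / (1 - c) * (1 + real m) powr (1 - c))"
      using F by (intro mult_left_mono sum_near_diagonal_le c fin) (auto simp: N_def)
    also have "\<dots> = 4 / (1 - c) * ((1 + real m) powr (c - 1 - t) * (1 + real m) powr (1 - c))" by simp
    also have "\<dots> = 4 / (1 - c) * (1 + real m) powr - t" unfolding powr_add[symmetric] by simp
    finally show ?thesis .
  qed
  finally show ?thesis by (simp add: G_def algebra_simps)
qed

lemma sum_nat_abs_le:
  fixes f :: "nat \<Rightarrow> real"
  assumes "finite F" "\<And>n. f n \<ge> 0"
  shows "(\<Sum>i\<in>F. f (nat \<bar>i\<bar>)) \<le> 2 * (\<Sum>n\<in>(\<lambda>i. nat \<bar>i\<bar>) ` F. f n)"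
proof -
  define N where "N = (\<lambda>i. nat \<bar>i\<bar>) ` F"
  have N: "finite N" using assms by (simp add: N_def)
  have "F \<subseteq> int ` N \<union> (\<lambda>n. - int n) ` N"
  proof
    fix i assume "i \<in> F"
    then have "nat \<bar>i\<bar> \<in> N" "i = int (nat \<bar>i\<bar>) \<or> i = - int (nat \<bar>i\<bar>)" by (auto simp: N_def)
    then show "i \<in> int ` N \<union> (\<lambda>n. - int n) ` N" by blast
  qed
  then have "(\<Sum>i\<in>F. f (nat \<bar>i\<bar>)) \<le> (\<Sum>i\<in>int ` N \<union> (\<lambda>n. - int n) ` N. f (nat \<bar>i\<bar>))"
    using N assms by (intro sum_mono2) auto
  also have "\<dots> \<le> (\<Sum>i\<in>int ` N. f (nat \<bar>i\<bar>)) + (\<Sum>i\<in>(\<lambda>n. - int n) ` N. f (nat \<bar>i\<bar>))"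
    using N assms by (subst sum.union_inter [symmetric]) (auto intro!: sum_nonneg)
  also have "\<dots> = 2 * sum f N" by (simp add: sum.reindex inj_on_def)
  finally show ?thesis by (simp add: N_def)
qed


text \<open>
  For integers \<open>i\<close> and \<open>j\<close> the numbers \<open>|i - j|\<close> and \<open>|i + j|\<close> are, in some order, the difference \<open>d\<close> and the
  sum \<open>s\<close> of the absolute values. As \<open>d \<le> s\<close> and the total degree is fixed, raising the
  exponent of \<open>d\<close> to \<open>c = max a b\<close> only increases the kernel, which reduces both orders to one kernel on
  the natural numbers. On the excluded lines \<open>i = j\<close> and \<open>i = - j\<close> the summand has
  the value 0 since \<open>0 powr a = 0\<close> and \<open>1 / 0 = 0\<close>, so \<open>F\<close> may be any finite set.
\<close>
lemma kernel_Schur_bound_int: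
  fixes a b t :: real
  assumes ab: "a > 0" "b > 0" "a + b = 1" and t: "0 < t" "t < 1"
  obtains A where "\<And>j F. finite F \<Longrightarrow>
    (\<Sum>i\<in>F. 1 / (\<bar>real_of_int i - real_of_int j\<bar> powr a * \<bar>real_of_int i + real_of_int j\<bar> powr b)
         * (1 + \<bar>real_of_int i\<bar>) powr - t)
      \<le> A * (1 + \<bar>real_of_int j\<bar>) powr - t"
proof -
  define c where "c = max a b"
  have c: "0 < c" "c < 1" "a \<le> c" "b \<le> c" using ab by (auto simp: c_def)
  have compare: "1 / (d powr x * s powr y) \<le> d powr - c * s powr (c - 1)"
    if "0 < d" "d \<le> s" "x \<le> c" "x + y = 1" for d s x y :: real
  proof -
    have "1 / (d powr x * s powr y) = d powr - c * (d powr (c - x) * s powr - y)"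
      using that by (simp add: powr_minus powr_diff field_simps)
    also have "\<dots> \<le> d powr - c * (s powr (c - x) * s powr - y)"
      using that by (intro mult_left_mono mult_right_mono powr_mono2) auto
    also have "s powr (c - x) * s powr - y = s powr (c - 1)"
      using that by (simp flip: powr_add add: algebra_simps)
    finally show ?thesis .
  qed
  define C where "C = 4 / (1 - t) + 8 / t + 4 / (1 - c)"
  define f where "f j i = 1 / (\<bar>real_of_int i - real_of_int j\<bar> powr a * \<bar>real_of_int i + real_of_int j\<bar> powr b)
         * (1 + \<bar>real_of_int i\<bar>) powr - t" for i j
  define g where "g m n = \<bar>real n - real m\<bar> powr - c * (real n + real m) powr (c - 1) * (1 + real n) powr - t" for m n
  have f_le: "f j i \<le> g (nat \<bar>j\<bar>) (nat \<bar>i\<bar>)" if "\<bar>i\<bar> \<noteq> \<bar>j\<bar>" for i j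
  proof -
    define x y where "x = real_of_int i" and "y = real_of_int j"
    have xy: "\<bar>x\<bar> \<noteq> \<bar>y\<bar>" using that unfolding x_def y_def by linarith
    have nn: "real (nat \<bar>i\<bar>) = \<bar>x\<bar>" "real (nat \<bar>j\<bar>) = \<bar>y\<bar>" by (simp_all add: x_def y_def)
    define d s where "d = \<bar>\<bar>x\<bar> - \<bar>y\<bar>\<bar>" and "s = \<bar>x\<bar> + \<bar>y\<bar>"
    have ds: "0 < d" "d \<le> s" using xy by (auto simp: d_def s_def)
    consider "\<bar>x - y\<bar> = d" "\<bar>x + y\<bar> = s" | "\<bar>x - y\<bar> = s" "\<bar>x + y\<bar> = d"
      unfolding d_def s_def by linarith
    then have "1 / (\<bar>x - y\<bar> powr a * \<bar>x + y\<bar> powr b) \<le> d powr - c * s powr (c - 1)"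
    proof cases
      case 1
      then show ?thesis using compare[OF ds c(3) ab(3)] by simp
    next
      case 2
      have "b + a = 1" using ab by simp
      from compare[OF ds c(4) this] show ?thesis unfolding 2 by (simp only: mult.commute)
    qed
    then show ?thesis
      unfolding f_def g_def nn by (fold x_def y_def d_def s_def) (intro mult_right_mono; simp)
  qed
  have "sum (f j) F \<le> 2 * C * (1 + \<bar>real_of_int j\<bar>) powr - t" if F: "finite F" for F j
  proof -
    define F' where "F' = {i\<in>F. \<bar>i\<bar> \<noteq> \<bar>j\<bar>}"
    have F': "finite F'" using F by (simp add: F'_def)
    have zero: "f j i = 0" if "\<bar>i\<bar> = \<bar>j\<bar>" for i
    proof -
      have "i = j \<or> i = - j" using that by linarith
      then show ?thesis by (auto simp: f_def)
    qed
    have "sum (f j) F = sum (f j) F'"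
      using F zero by (intro sum.mono_neutral_right) (auto simp: F'_def)
    also have "\<dots> \<le> (\<Sum>i\<in>F'. g (nat \<bar>j\<bar>) (nat \<bar>i\<bar>))"
      by (intro sum_mono f_le) (auto simp: F'_def)
    also have "\<dots> \<le> 2 * (\<Sum>n\<in>(\<lambda>i. nat \<bar>i\<bar>) ` F'. g (nat \<bar>j\<bar>) n)"
      by (intro sum_nat_abs_le F') (auto simp: g_def)
    also have "(\<Sum>n\<in>(\<lambda>i. nat \<bar>i\<bar>) ` F'. g (nat \<bar>j\<bar>) n) \<le> C * (1 + real (nat \<bar>j\<bar>)) powr - t"
      unfolding g_def C_def using F' by (intro kernel_Schur_bound_nat c t) (auto simp: F'_def)
    finally show ?thesis by simp
  qed
  then show thesis by (intro that[of "2 * C"]) (simp add: f_def)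
qed

section \<open>The operator\<close>

text \<open>
  A single index \<open>j\<close> gives convergence of the inner sum; the bound itself survives the limit over \<open>F\<close>
  because only finitely many continuous functions of inner sums are added.
\<close>
lemma finite_section_bound_extends:
  fixes h :: "'a \<Rightarrow> 'b \<Rightarrow> real"
  assumes h: "\<And>i j. h i j \<ge> 0" and q: "q > 0"
    and bound: "\<And>F G. finite F \<Longrightarrow> finite G \<Longrightarrow> (\<Sum>j\<in>G. (\<Sum>i\<in>F. h i j) powr q) \<le> M"
  shows "(\<lambda>i. h i j) summable_on UNIV"
    and "finite G \<Longrightarrow> (\<Sum>j\<in>G. (\<Sum>\<^sub>\<infinity>i. h i j) powr q) \<le> M"
proof -
  show summ: "(\<lambda>i. h i j) summable_on UNIV" for j
  proof (rule nonneg_bdd_above_summable_on)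
    have "sum (\<lambda>i. h i j) F \<le> M powr (1 / q)" if "finite F" for F
    proof -
      have "sum (\<lambda>i. h i j) F = ((\<Sum>i\<in>F. h i j) powr q) powr (1 / q)"
        using h q by (simp add: powr_powr sum_nonneg)
      also have "\<dots> \<le> M powr (1 / q)"
        using bound[OF that, of "{j}"] q by (intro powr_mono2) auto
      finally show ?thesis .
    qed
    then show "bdd_above (sum (\<lambda>i. h i j) ` {F. F \<subseteq> UNIV \<and> finite F})"
      by (auto intro!: bdd_aboveI)
  qed (use h in auto)
  assume G: "finite G"
  have "((\<lambda>F. \<Sum>j\<in>G. (\<Sum>i\<in>F. h i j) powr q) \<longlongrightarrow> (\<Sum>j\<in>G. (\<Sum>\<^sub>\<infinity>i. h i j) powr q)) (finite_subsets_at_top UNIV)"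
    using h q by (intro tendsto_sum tendsto_powr' infsum_tendsto summ tendsto_const)
      (auto intro!: always_eventually sum_nonneg)
  then show "(\<Sum>j\<in>G. (\<Sum>\<^sub>\<infinity>i. h i j) powr q) \<le> M"
    by (rule tendsto_upperbound) (auto intro!: eventually_finite_subsets_at_top_weakI bound G)
qed

text \<open>
  For fixed \<open>\<gamma>\<close>, with the norm bound \<open>C = A powr (1 / r)\<close>, where \<open>A\<close> serves in the kernel
  estimate for both weights, \<open>t = s * p'\<close> for the rows and \<open>t = s * q\<close> for the columns.
\<close>
lemma T_op_bounded:
  fixes \<alpha> \<beta> \<gamma> p q :: real
  assumes g: "0 \<le> \<gamma>" "\<gamma> < 1" and ab: "\<alpha> > 0" "\<beta> > 0" "\<alpha> + \<beta> = 1 - \<gamma>"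
    and p: "1 < p" "\<gamma> = 0 \<or> p < 1 / \<gamma>" and q: "1 / q = 1 / p - \<gamma>"
  obtains C where "\<And>b. b \<in> lp_space p \<Longrightarrow> T_converges \<alpha> \<beta> b \<and>
       T_op \<alpha> \<beta> b \<in> lp_space q \<and> lp_norm q (T_op \<alpha> \<beta> b) \<le> C * lp_norm p b"
proof -
  have "1 / p - \<gamma> > 0" 
    using p g by (cases "\<gamma> = 0") (auto simp: less_divide_eq mult.commute)
  then have q0: "q > 0" using q by (metis zero_less_divide_1_iff)
  define r where "r = 1 / (1 - \<gamma>)"
  have r: "r > 0" "1 / r = 1 - \<gamma>" using g by (auto simp: r_def)
  define p' where "p' = p / (p - 1)"
  have p': "p' > 0" using p by (simp add: p'_def)
  (* Any s > 0 with s * p' < 1 and s * q < 1 would do. *)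
  define s where "s = 1 / (p' + q)"
  have s: "s > 0" "s * p' > 0" "s * p' < 1" "s * q > 0" "s * q < 1"
    using p' q0 by (auto simp: s_def)
  have abr: "\<alpha> * r > 0" "\<beta> * r > 0" "\<alpha> * r + \<beta> * r = 1"
    using ab r g by (auto simp: r_def simp flip: add_divide_distrib)
  define K :: "int \<Rightarrow> int \<Rightarrow> real" where
    "K i j = 1 / (\<bar>real_of_int i - real_of_int j\<bar> powr \<alpha> * \<bar>real_of_int i + real_of_int j\<bar> powr \<beta>)" for i j
  define u :: "int \<Rightarrow> real" where "u i = (1 + \<bar>real_of_int i\<bar>) powr s" for i
  have K0: "K i j \<ge> 0" for i j by (simp add: K_def)
  have K_sym: "K i j = K j i" for i j by (simp add: K_def abs_minus_commute add.commute)
  have Kr: "K i j powr r = 1 / (\<bar>real_of_int i - real_of_int j\<bar> powr (\<alpha> * r) * \<bar>real_of_int i + real_of_int j\<bar> powr (\<beta> * r))" for i j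
    by (simp add: K_def powr_divide powr_mult powr_powr)
  have u_powr: "u i powr - x = (1 + \<bar>real_of_int i\<bar>) powr - (s * x)" for i x
    by (simp add: u_def powr_powr)
  have u: "u i > 0" for i by (simp add: u_def)
  obtain A1 where A1: "\<And>j F. finite F \<Longrightarrow> (\<Sum>i\<in>F. K i j powr r * u i powr - p') \<le> A1 * u j powr - p'"
    using kernel_Schur_bound_int[OF abr s(2,3)] unfolding Kr u_powr by blast
  obtain A2 where A2: "\<And>j F. finite F \<Longrightarrow> (\<Sum>i\<in>F. K i j powr r * u i powr - q) \<le> A2 * u j powr - q"
    using kernel_Schur_bound_int[OF abr s(4,5)] unfolding Kr u_powr by blast
  define A where "A = max 0 (max A1 A2)"
  have A: "A \<ge> 0" "A \<ge> A1" "A \<ge> A2" by (auto simp: A_def)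
  have row: "(\<Sum>i\<in>F. K i j powr r * u i powr - p') \<le> A * u j powr - p'" if "finite F" for F j
    by (rule order_trans[OF A1[OF that]]) (intro mult_right_mono A; simp)
  have col: "(\<Sum>j\<in>F. K i j powr r * u j powr - q) \<le> A * u i powr - q" if "finite F" for F i
    unfolding K_sym[of i] by (rule order_trans[OF A2[OF that]]) (intro mult_right_mono A; simp)
  show thesis
  proof (rule that[of "A powr (1 / r)"])
    fix b assume b: "b \<in> lp_space p"
    define B where "B = (\<Sum>\<^sub>\<infinity>i. norm (b i) powr p)"
    have bs: "(\<lambda>i. norm (b i) powr p) summable_on UNIV" using b by (simp add: lp_space_def)
    have B0: "B \<ge> 0" by (simp add: B_def infsum_nonneg)
    define M where "M = A powr (q / r) * B powr (q / p)"
    have bound: "(\<Sum>j\<in>G. (\<Sum>i\<in>F. K i j * norm (b i)) powr q) \<le> M" if "finite F" "finite G" for F G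
    proof -
      have "(\<Sum>j\<in>G. (\<Sum>i\<in>F. K i j * norm (b i)) powr q)
          \<le> A powr (q / r) * (\<Sum>i\<in>F. norm (b i) powr p) powr (q / p)"
        using K0 u p(1) q0 r q g A row col that
        by (intro weighted_Young_finite[where u = u and v = u and \<gamma> = \<gamma> and p' = p']) (auto simp: p'_def)
      also have "\<dots> \<le> M"
        unfolding M_def B_def using p q0 that bs
        by (intro mult_left_mono powr_mono2 finite_sum_le_infsum sum_nonneg) auto
      finally show ?thesis .
    qed
    have h0: "K i j * norm (b i) \<ge> 0" for i j by (simp add: K0)
    have summ: "(\<lambda>i. K i j * norm (b i)) summable_on UNIV" for j
      by (rule finite_section_bound_extends(1)[OF h0 q0]) (rule bound)
    have total: "(\<Sum>j\<in>G. (\<Sum>\<^sub>\<infinity>i. K i j * norm (b i)) powr q) \<le> M" if "finite G" for G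
      by (rule finite_section_bound_extends(2)[OF h0 q0 _ that]) (rule bound)
    have norm_T: "norm (T_summand \<alpha> \<beta> b j i) = K i j * norm (b i)" for i j
      by (simp add: T_summand_def K_def norm_divide norm_mult abs_mult)
    have abs_summ: "(\<lambda>i. norm (T_summand \<alpha> \<beta> b j i)) summable_on UNIV" for j
      unfolding norm_T by (rule summ)
    have "T_summand \<alpha> \<beta> b j summable_on S" for j S
      by (rule summable_on_subset_banach[OF abs_summable_summable[OF abs_summ] subset_UNIV])
    then have conv: "T_converges \<alpha> \<beta> b" by (simp add: T_converges_def)
    have "T_op \<alpha> \<beta> b j = (\<Sum>\<^sub>\<infinity>i. T_summand \<alpha> \<beta> b j i)" for j
      unfolding T_op_def by (rule infsum_cong_neutral) (auto simp: T_summand_def)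
    then have T_le: "norm (T_op \<alpha> \<beta> b j) \<le> (\<Sum>\<^sub>\<infinity>i. K i j * norm (b i))" for j
      using norm_infsum_bound[OF abs_summ, of j] by (simp add: norm_T)
    have T_sum: "(\<Sum>j\<in>G. norm (T_op \<alpha> \<beta> b j) powr q) \<le> M" if "finite G" for G
      using q0 by (intro order_trans[OF sum_mono total[OF that]] powr_mono2 T_le) auto
    have summ_T: "(\<lambda>j. norm (T_op \<alpha> \<beta> b j) powr q) summable_on UNIV"
      by (rule nonneg_bdd_above_summable_on) (auto intro!: bdd_aboveI T_sum)
    have "(\<Sum>\<^sub>\<infinity>j. norm (T_op \<alpha> \<beta> b j) powr q) \<le> M"
      by (intro infsum_le_finite_sums summ_T T_sum)
    then have "lp_norm q (T_op \<alpha> \<beta> b) \<le> M powr (1 / q)"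
      unfolding lp_norm_def using q0 by (intro powr_mono2 infsum_nonneg) auto
    also have "\<dots> = A powr (1 / r) * lp_norm p b"
      using q0 A B0 by (simp add: M_def lp_norm_def powr_mult powr_powr B_def)
    finally show "T_converges \<alpha> \<beta> b \<and> T_op \<alpha> \<beta> b \<in> lp_space q \<and>
        lp_norm q (T_op \<alpha> \<beta> b) \<le> A powr (1 / r) * lp_norm p b"
      using conv summ_T by (simp add: lp_space_def)
  qed
qed

theorem theorem7:
  fixes \<alpha> \<beta> p q :: real
  shows "\<exists>C::real. \<forall>\<gamma>::real.
    0 \<le> \<gamma> \<and> \<gamma> < 1 \<and> \<alpha> > 0 \<and> \<beta> > 0 \<and> \<alpha> + \<beta> = 1 - \<gamma> \<and>
    1 < p \<and> (\<gamma> = 0 \<or> p < 1 / \<gamma>) \<and> 1 / q = 1 / p - \<gamma> \<longrightarrow>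
    (\<forall>b\<in>lp_space p.
       T_converges \<alpha> \<beta> b \<and>
       T_op \<alpha> \<beta> b \<in> lp_space q \<and>
       lp_norm q (T_op \<alpha> \<beta> b) \<le> C * lp_norm p b)"
  (* The constant may be chosen after \<gamma>, as the relation \<alpha> + \<beta> = 1 - \<gamma> admits at most one \<gamma>. *)
proof (cases "\<exists>\<gamma>::real. 0 \<le> \<gamma> \<and> \<gamma> < 1 \<and> \<alpha> > 0 \<and> \<beta> > 0 \<and> \<alpha> + \<beta> = 1 - \<gamma> \<and>
    1 < p \<and> (\<gamma> = 0 \<or> p < 1 / \<gamma>) \<and> 1 / q = 1 / p - \<gamma>")
  case True
  then obtain \<gamma> :: real where "0 \<le> \<gamma>" "\<gamma> < 1" "\<alpha> > 0" "\<beta> > 0" "\<alpha> + \<beta> = 1 - \<gamma>"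
    "1 < p" "\<gamma> = 0 \<or> p < 1 / \<gamma>" "1 / q = 1 / p - \<gamma>" by blast
  then show ?thesis using T_op_bounded by metis
qed blast

end
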